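(* Let $k\ge 3$ and let $G$ be an even $k$-melon graph with paths $P^{(1)},\dots,P^{(k)}$. For $i\in\{1,\dots,k\}$ let $U_i$ be the vertex set such that $P^{(i)}$ is external with respect to $U_i$ and every $P^{(j)}$, $j\ne i$, is internal with respect to $U_i$. Then $\mathrm{evc}(G)=\mathrm{vc}(G)+1$, and $\mathcal{U}=\{U_i : i\in\{1,\dots,k\}\}$ is a minimum eternal vertex cover class of $G$.
   Context: For $k\ge1$, a $k$-melon graph is the union of $k$ pairwise internally vertex-disjoint paths $P^{(1)},\dots,P^{(k)}$, each of length at least $1$, with the same two distinct endpoints $s$ and $t$; it is even if every path has even length. For a path $P$ of length $2m$ with vertices $v_0,\dots,v_{2m}$, $\{v_0,v_{2m}\}=\{s,t\}$, and a vertex set $U$: $P$ is internal w.r.t. $U$ if $U\cap V(P)=\{v_{2j}:0\le j\le m\}$, and external w.r.t. $U$ if $U\cap V(P)=\{v_{2j+1}:0\le j\le m-1\}\cup\{s,t\}$. $\mathrm{vc}(G)$ is the vertex cover number. For a vertex cover $U$ of $G=(V,E)$ and an edge $e=vw$, a defense of $U$ against $e$ is a one-to-one map $\phi:U\to V$ with $\phi(u)\in N[u]$ for all $u\in U$ and $\phi(v)=w$ (with $v\in U$) or $\phi(w)=v$ (with $w\in U$). An eternal vertex cover class is a family $\mathcal{U}$ of vertex covers of equal cardinality (its size) such that for every $U\in\mathcal{U}$ and every edge $e$ there is a defense $\phi$ of $U$ against $e$ with $\phi(U)\in\mathcal{U}$; $\mathrm{evc}(G)$ is the minimum size of such a class,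 and a class of that size is minimum. *)

theory Defs
  imports Main "HOL-Library.FuncSet"
begin

record 'a ugraph =
  verts :: "'a set"
  edges :: "'a set set"

definition closed_nbhd :: "'a ugraph \<Rightarrow> 'a \<Rightarrow> 'a set" where
  "closed_nbhd G u = insert u {w \<in> verts G. {u, w} \<in> edges G}"

definition vertex_cover :: "'a ugraph \<Rightarrow> 'a set \<Rightarrow> bool" where
  "vertex_cover G U \<longleftrightarrow> finite U \<and> U \<subseteq> verts G \<and> (\<forall>e \<in> edges G. e \<inter> U \<noteq> {})"

definition vc :: "'a ugraph \<Rightarrow> nat" where
  "vc G = (LEAST n. \<exists>U. vertex_cover G U \<and> card U = n)"

definition defense :: "'a ugraph \<Rightarrow> 'a set \<Rightarrow> 'a set \<Rightarrow> ('a \<Rightarrow> 'a) \<Rightarrow> bool" where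
  "defense G U e \<phi> \<longleftrightarrow>
     \<phi> \<in> U \<rightarrow> verts G \<and> inj_on \<phi> U \<and> (\<forall>u \<in> U. \<phi> u \<in> closed_nbhd G u) \<and>
     (\<exists>v w. e = {v, w} \<and> (v \<in> U \<and> \<phi> v = w \<or> w \<in> U \<and> \<phi> w = v))"

text \<open>The family has to be nonempty: otherwise it has no size, and the empty family
  would satisfy the remaining conditions for every \<open>n\<close>.\<close>

definition evc_class :: "'a ugraph \<Rightarrow> nat \<Rightarrow> 'a set set \<Rightarrow> bool" where
  "evc_class G n \<U> \<longleftrightarrow>
     \<U> \<noteq> {} \<and> (\<forall>U \<in> \<U>. vertex_cover G U \<and> card U = n) \<and>
     (\<forall>U \<in> \<U>. \<forall>e \<in> edges G. \<exists>\<phi>. defense G U e \<phi> \<and> \<phi> ` U \<in> \<U>)"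

definition evc :: "'a ugraph \<Rightarrow> nat" where
  "evc G = (LEAST n. \<exists>\<U>. evc_class G n \<U>)"

definition minimum_evc_class :: "'a ugraph \<Rightarrow> 'a set set \<Rightarrow> bool" where
  "minimum_evc_class G \<U> \<longleftrightarrow> evc_class G (evc G) \<U>"

text \<open>A path is given by the list of its vertices \<open>v\<^sub>0, \<dots>, v\<^sub>n\<close>, which has length \<open>n + 1\<close>.\<close>

definition path_length :: "'a list \<Rightarrow> nat" where
  "path_length p = length p - 1"

definition path_edges :: "'a list \<Rightarrow> 'a set set" where
  "path_edges p = {{p ! j, p ! Suc j} | j. j < path_length p}"

definition path_between :: "'a list \<Rightarrow> 'a \<Rightarrow> 'a \<Rightarrow> bool" where
  "path_between p s t \<longleftrightarrow> p \<noteq> [] \<and> distinct p \<and> {hd p, last p} = {s, t}"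

definition melon :: "nat \<Rightarrow> 'a ugraph \<Rightarrow> (nat \<Rightarrow> 'a list) \<Rightarrow> 'a \<Rightarrow> 'a \<Rightarrow> bool" where
  "melon k G P s t \<longleftrightarrow>
     k \<ge> 1 \<and> s \<noteq> t \<and>
     (\<forall>i \<in> {1..k}. path_between (P i) s t \<and> path_length (P i) \<ge> 1) \<and>
     (\<forall>i \<in> {1..k}. \<forall>j \<in> {1..k}. i \<noteq> j \<longrightarrow>
        (set (P i) - {s, t}) \<inter> (set (P j) - {s, t}) = {}) \<and>
     verts G = (\<Union>i \<in> {1..k}. set (P i)) \<and>
     edges G = (\<Union>i \<in> {1..k}. path_edges (P i))"

definition even_melon :: "nat \<Rightarrow> 'a ugraph \<Rightarrow> (nat \<Rightarrow> 'a list) \<Rightarrow> 'a \<Rightarrow> 'a \<Rightarrow> bool" where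
  "even_melon k G P s t \<longleftrightarrow> melon k G P s t \<and> (\<forall>i \<in> {1..k}. even (path_length (P i)))"

text \<open>The next two notions are meant for paths of even length \<open>2 * m\<close>, for which
  \<open>path_length p div 2 = m\<close>.\<close>

definition internal_path :: "'a list \<Rightarrow> 'a set \<Rightarrow> bool" where
  "internal_path p U \<longleftrightarrow> U \<inter> set p = {p ! (2 * j) | j. j \<le> path_length p div 2}"

definition external_path :: "'a list \<Rightarrow> 'a set \<Rightarrow> bool" where
  "external_path p U \<longleftrightarrow>
     U \<inter> set p = {p ! (2 * j + 1) | j. j < path_length p div 2} \<union> {hd p, last p}"

definition melon_cover :: "nat \<Rightarrow> 'a ugraph \<Rightarrow> (nat \<Rightarrow> 'a list) \<Rightarrow> nat \<Rightarrow> 'a set" where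
  "melon_cover k G P i =
     (THE U. U \<subseteq> verts G \<and> external_path (P i) U \<and>
        (\<forall>j \<in> {1..k}. j \<noteq> i \<longrightarrow> internal_path (P j) U))"

end

theory Submission
  imports Defs
begin

text \<open>Orient every path from \<open>s\<close> to \<open>t\<close> and let the \<open>r\<close>-th one have length \<open>2 * m r\<close>.
  A vertex cover has at least \<open>m r - 1\<close> interior vertices on each path, and at least \<open>m r\<close> if it
  contains a neighbour of \<open>s\<close> or \<open>t\<close> there. A cover that misses \<open>s\<close> or \<open>t\<close> contains such a
  neighbour on every path, which for \<open>k \<ge> 3\<close> is more expensive than containing both. So the
  vertex cover number is \<open>2 + (\<Sum>r. m r - 1)\<close>, no cover of this size contains the second vertex of
  a path, and an attack on the first edge of a path cannot be defended within this size.
  Conversely, from \<open>U\<^sub>i\<close> to \<open>U\<^sub>r\<close> the guards can be shifted along the cycle formed by the paths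
  \<open>i\<close> and \<open>r\<close>, through \<open>t\<close> while \<open>s\<close> stands still, or through \<open>s\<close> while \<open>t\<close> stands still. Each
  edge of the two paths is traversed in one of the two shifts.\<close>

section \<open>Even melon graphs in position coordinates\<close>

locale even_melon_coords =
  fixes G :: "'a ugraph" and K :: "nat set" and m :: "nat \<Rightarrow> nat"
    and v :: "nat \<Rightarrow> nat \<Rightarrow> 'a" and s t :: 'a
  assumes finite_K: "finite K"
    and m_pos: "r \<in> K \<Longrightarrow> 0 < m r"
    and s_neq_t: "s \<noteq> t"
    and v_first: "r \<in> K \<Longrightarrow> v r 0 = s"
    and v_last: "r \<in> K \<Longrightarrow> v r (2 * m r) = t"
    and v_eqD: "\<lbrakk>r \<in> K; r' \<in> K; j \<le> 2 * m r; j' \<le> 2 * m r'; v r j = v r' j'\<rbrakk> \<Longrightarrow>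
      r = r' \<and> j = j' \<or> j = 0 \<and> j' = 0 \<or> j = 2 * m r \<and> j' = 2 * m r'"
    and verts_eq: "verts G = {v r j | r j. r \<in> K \<and> j \<le> 2 * m r}"
    and edges_eq: "edges G = {{v r j, v r (Suc j)} | r j. r \<in> K \<and> j < 2 * m r}"
begin

text \<open>The index is not restricted to \<open>K\<close>: for \<open>i\<close> outside
  \<open>K\<close> every path is internal, and the set is then a minimum vertex cover instead of one
  of the sets of the class. The disjuncts for the ends matter only on path \<open>i\<close>, because
  0 and \<open>2 * m r\<close> are even.\<close>

definition cover :: "nat \<Rightarrow> 'a set" where
  "cover i = {v r j | r j. r \<in> K \<and> j \<le> 2 * m r \<and>
     (j = 0 \<or> j = 2 * m r \<or> (if r = i then odd j else even j))}"

text \<open>Positions are collected rather than vertices, so that lower bounds reduce to arithmetic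
  maps such as halving.\<close>

definition interior :: "nat \<Rightarrow> 'a set \<Rightarrow> nat set" where
  "interior r U = {j. 0 < j \<and> j < 2 * m r \<and> v r j \<in> U}"

lemma v_in_cover_iff:
  assumes "r \<in> K" "j \<le> 2 * m r"
  shows "v r j \<in> cover i \<longleftrightarrow> j = 0 \<or> j = 2 * m r \<or> (if r = i then odd j else even j)"
proof
  assume "v r j \<in> cover i"
  then obtain r' j' where *: "r' \<in> K" "j' \<le> 2 * m r'" "v r j = v r' j'"
    "j' = 0 \<or> j' = 2 * m r' \<or> (if r' = i then odd j' else even j')"
    unfolding cover_def by blast
  show "j = 0 \<or> j = 2 * m r \<or> (if r = i then odd j else even j)"
    using v_eqD[OF assms(1) *(1) assms(2) *(2,3)] *(4) by auto
next
  assume "j = 0 \<or> j = 2 * m r \<or> (if r = i then odd j else even j)"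
  then show "v r j \<in> cover i"
    using assms unfolding cover_def by blast
qed

lemma cover_subset_verts: "cover i \<subseteq> verts G"
  by (auto simp: cover_def verts_eq)

lemma finite_verts: "finite (verts G)"
proof -
  have "verts G = (\<Union>r\<in>K. v r ` {..2 * m r})"
    by (auto simp: verts_eq)
  then show ?thesis
    using finite_K by simp
qed

lemma v_inj_on:
  assumes "r \<in> K"
  shows "inj_on (v r) {..2 * m r}"
  by (rule inj_onI) (use v_eqD[OF assms assms] in auto)

lemma finite_interior: "finite (interior r U)"
  by (simp add: interior_def)

text \<open>By \<open>v_eqD\<close> different paths meet only in \<open>s\<close> and
  \<open>t\<close>, and positions strictly inside a path give distinct vertices. So \<open>U\<close>
  splits disjointly into its ends and one piece per path.\<close>

lemma card_eq_sum_interior: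
  assumes "U \<subseteq> verts G"
  shows "card U = card (U \<inter> {s, t}) + (\<Sum>r\<in>K. card (interior r U))"
proof -
  let ?I = "\<lambda>r. v r ` interior r U"
  have U: "U = (U \<inter> {s, t}) \<union> (\<Union>r\<in>K. ?I r)"
  proof
    show "U \<subseteq> (U \<inter> {s, t}) \<union> (\<Union>r\<in>K. ?I r)"
    proof
      fix x assume x: "x \<in> U"
      then obtain r j where rj: "r \<in> K" "j \<le> 2 * m r" "x = v r j"
        using assms verts_eq by blast
      show "x \<in> (U \<inter> {s, t}) \<union> (\<Union>r\<in>K. ?I r)"
      proof (cases "j = 0 \<or> j = 2 * m r")
        case True
        then show ?thesis using rj x v_first v_last by auto
      next
        case False
        then have "j \<in> interior r U" using rj x by (auto simp: interior_def)
        then show ?thesis using rj by blast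
      qed
    qed
  qed (auto simp: interior_def)
  have disj: "(U \<inter> {s, t}) \<inter> (\<Union>r\<in>K. ?I r) = {}"
  proof -
    have False if "r \<in> K" "j \<in> interior r U" "v r j = s \<or> v r j = t" for r j
      using v_eqD[OF that(1,1), of j 0] v_eqD[OF that(1,1), of j "2 * m r"] that
      by (auto simp: interior_def v_first v_last)
    then show ?thesis by blast
  qed
  have disj': "?I r \<inter> ?I r' = {}" if "r \<in> K" "r' \<in> K" "r \<noteq> r'" for r r'
  proof -
    have False if "a \<in> interior r U" "b \<in> interior r' U" "v r a = v r' b" for a b
      using v_eqD[OF \<open>r \<in> K\<close> \<open>r' \<in> K\<close>, of a b] that \<open>r \<noteq> r'\<close> by (auto simp: interior_def)
    then show ?thesis by blast
  qed
  have "card U = card (U \<inter> {s, t}) + card (\<Union>r\<in>K. ?I r)"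
    by (subst U, rule card_Un_disjoint) (use disj finite_K finite_interior in auto)
  also have "card (\<Union>r\<in>K. ?I r) = (\<Sum>r\<in>K. card (?I r))"
    by (rule card_UN_disjoint) (use disj' finite_K finite_interior in auto)
  also have "\<dots> = (\<Sum>r\<in>K. card (interior r U))"
  proof (rule sum.cong[OF refl])
    fix r assume "r \<in> K"
    then show "card (?I r) = card (interior r U)"
      by (intro card_image inj_on_subset[OF v_inj_on]) (auto simp: interior_def)
  qed
  finally show ?thesis .
qed

lemma s_t_in_cover:
  assumes "K \<noteq> {}"
  shows "s \<in> cover i" "t \<in> cover i"
proof -
  obtain r where "r \<in> K" using assms by blast
  then show "s \<in> cover i" "t \<in> cover i"
    using v_in_cover_iff[of r 0 i] v_in_cover_iff[of r "2 * m r" i]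
    by (auto simp: v_first v_last)
qed

lemma card_interior_cover:
  assumes "r \<in> K"
  shows "card (interior r (cover i)) = (m r - 1) + (if r = i then 1 else 0)"
proof (cases "r = i")
  case True
  have "interior r (cover i) = (\<lambda>j. 2 * j + 1) ` {..<m r}"
    using True assms v_in_cover_iff[OF assms, of _ i]
    by (auto simp: interior_def elim!: oddE)
  then show ?thesis
    using True m_pos[OF assms] by (simp add: card_image inj_on_def)
next
  case False
  have "interior r (cover i) = (\<lambda>j. 2 * j) ` {1..<m r}"
    using False assms v_in_cover_iff[OF assms, of _ i]
    by (auto simp: interior_def elim!: evenE)
  then show ?thesis
    using False by (simp add: card_image inj_on_def)
qed

lemma card_cover:
  assumes "K \<noteq> {}"
  shows "card (cover i) = 2 + (\<Sum>r\<in>K. m r - 1) + (if i \<in> K then 1 else 0)"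
proof -
  have "cover i \<inter> {s, t} = {s, t}"
    using s_t_in_cover[OF assms] by auto
  then have "card (cover i) = 2 + (\<Sum>r\<in>K. (m r - 1) + (if r = i then 1 else 0))"
    using card_eq_sum_interior[OF cover_subset_verts, of i] s_neq_t
    by (simp add: card_interior_cover)
  then show ?thesis
    using finite_K by (simp add: sum.distrib)
qed

text \<open>Of two consecutive positions, one has the parity that \<open>cover i\<close> takes on
  the path. This holds for every \<open>i\<close>, in \<open>K\<close> or not.\<close>

lemma vertex_cover_cover: "vertex_cover G (cover i)"
proof -
  have "{v r j, v r (Suc j)} \<inter> cover i \<noteq> {}" if "r \<in> K" "j < 2 * m r" for r j
    using that v_in_cover_iff[of r j i] v_in_cover_iff[of r "Suc j" i] by auto
  moreover have "finite (cover i)"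
    using cover_subset_verts finite_verts by (rule finite_subset)
  ultimately show ?thesis
    unfolding vertex_cover_def edges_eq using cover_subset_verts by blast
qed

section \<open>Lower bounds on vertex covers and the vertex cover number\<close>

lemma vertex_cover_edge:
  assumes "vertex_cover G U" "r \<in> K" "j < 2 * m r"
  shows "v r j \<in> U \<or> v r (Suc j) \<in> U"
proof -
  have "{v r j, v r (Suc j)} \<in> edges G"
    using assms edges_eq by blast
  then have "{v r j, v r (Suc j)} \<inter> U \<noteq> {}"
    using assms(1) unfolding vertex_cover_def by metis
  then show ?thesis by auto
qed

text \<open>The edges between positions \<open>2 * j\<close> and \<open>2 * j + 1\<close> with 1
  \<le> j < m r form a matching that avoids both ends. Each needs its own vertex of
  \<open>U\<close>, and halving a position recovers the edge.\<close>

lemma card_interior_ge: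
  assumes "vertex_cover G U" "r \<in> K"
  shows "m r - 1 \<le> card (interior r U)"
proof -
  have "{1..<m r} \<subseteq> (\<lambda>j. j div 2) ` interior r U"
  proof
    fix j assume j: "j \<in> {1..<m r}"
    then have "v r (2 * j) \<in> U \<or> v r (Suc (2 * j)) \<in> U"
      using vertex_cover_edge[OF assms, of "2 * j"] by simp
    then have "2 * j \<in> interior r U \<or> Suc (2 * j) \<in> interior r U"
      using j by (auto simp: interior_def)
    then show "j \<in> (\<lambda>j. j div 2) ` interior r U"
      by (auto simp: image_iff intro: bexI[of _ "2 * j"] bexI[of _ "Suc (2 * j)"])
  qed
  from surj_card_le[OF finite_interior this] show ?thesis by simp
qed

lemma card_interior_ge_first:
  assumes "vertex_cover G U" "r \<in> K" "v r 1 \<in> U"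
  shows "m r \<le> card (interior r U)"
proof -
  have "{..<m r} \<subseteq> (\<lambda>j. j div 2) ` interior r U"
  proof
    fix j assume j: "j \<in> {..<m r}"
    \<comment> \<open>Compared with the general bound, the matching gains the edge
      \<open>j = 0\<close> at the start of the path, which is covered at the interior position 1 by
      assumption.\<close>
    then have "v r (2 * j) \<in> U \<or> v r (Suc (2 * j)) \<in> U"
      using vertex_cover_edge[OF assms(1,2), of "2 * j"] by simp
    then have "2 * j \<in> interior r U \<or> Suc (2 * j) \<in> interior r U"
      using j assms(3) by (cases j) (auto simp: interior_def)
    then show "j \<in> (\<lambda>j. j div 2) ` interior r U"
      by (auto simp: image_iff intro: bexI[of _ "2 * j"] bexI[of _ "Suc (2 * j)"])
  qed
  from surj_card_le[OF finite_interior this] show ?thesis by simp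
qed

text \<open>Here the matching is moved by one, to positions \<open>2 * j + 1\<close> and
  \<open>2 * j + 2\<close>. Its last edge ends in \<open>t\<close>, which is missing from
  \<open>U\<close>, so its other end has to be chosen.\<close>

lemma card_interior_ge_last:
  assumes "vertex_cover G U" "r \<in> K" "t \<notin> U"
  shows "m r \<le> card (interior r U)"
proof -
  have "{..<m r} \<subseteq> (\<lambda>j. (j - 1) div 2) ` interior r U"
  proof
    fix j assume j: "j \<in> {..<m r}"
    then have "v r (2 * j + 1) \<in> U \<or> v r (2 * j + 2) \<in> U"
      using vertex_cover_edge[OF assms(1,2), of "2 * j + 1"] by simp
    moreover have "v r (2 * j + 2) \<notin> U" if "Suc j = m r"
      using v_last[OF assms(2)] assms(3) that by (metis add_2_eq_Suc' mult_Suc_right add.commute)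
    ultimately have "2 * j + 1 \<in> interior r U \<or> 2 * j + 2 \<in> interior r U"
      using j by (cases "Suc j = m r") (auto simp: interior_def)
    then show "j \<in> (\<lambda>j. (j - 1) div 2) ` interior r U"
      by (auto simp: image_iff intro: bexI[of _ "2 * j + 1"] bexI[of _ "2 * j + 2"])
  qed
  from surj_card_le[OF finite_interior this] show ?thesis by simp
qed

text \<open>Each path pays one vertex more than its minimum. That is at least 3 in total, while at
  most 2 vertices are saved at the ends; this is where three paths are needed.\<close>

lemma vertex_cover_card_gt_missing_end:
  assumes "vertex_cover G U" "3 \<le> card K" "s \<notin> U \<or> t \<notin> U"
  shows "2 + (\<Sum>r\<in>K. m r - 1) < card U"
proof -
  \<comment> \<open>The bound \<open>m r\<close> is written as \<open>m r - 1 + 1\<close> so that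
    the sum over \<open>K\<close> splits off \<open>card K\<close>.\<close>
  have "m r - 1 + 1 \<le> card (interior r U)" if r: "r \<in> K" for r
  proof (cases "t \<in> U")
    case True
    then have "v r 1 \<in> U"
      using vertex_cover_edge[OF assms(1) r, of 0] assms(3) m_pos[OF r] v_first[OF r] by simp
    then show ?thesis
      using card_interior_ge_first[OF assms(1) r] m_pos[OF r] by simp
  next
    case False
    then show ?thesis
      using card_interior_ge_last[OF assms(1) r] m_pos[OF r] by simp
  qed
  then have "(\<Sum>r\<in>K. m r - 1 + 1) \<le> (\<Sum>r\<in>K. card (interior r U))"
    by (rule sum_mono)
  then have "(\<Sum>r\<in>K. m r - 1) + card K \<le> (\<Sum>r\<in>K. card (interior r U))"
    by (simp only: sum.distrib) simp
  then show ?thesis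
    using card_eq_sum_interior[of U] assms(1,2) by (simp add: vertex_cover_def)
qed

lemma vertex_cover_card_ge:
  assumes "vertex_cover G U" "3 \<le> card K"
  shows "2 + (\<Sum>r\<in>K. m r - 1) \<le> card U"
proof (cases "s \<in> U \<and> t \<in> U")
  case True
  then have "U \<inter> {s, t} = {s, t}" by auto
  then have "card U = 2 + (\<Sum>r\<in>K. card (interior r U))"
    using card_eq_sum_interior[of U] assms(1) s_neq_t by (simp add: vertex_cover_def)
  then show ?thesis
    using sum_mono[of K "\<lambda>r. m r - 1"] card_interior_ge[OF assms(1)] by simp
next
  case False
  then show ?thesis
    using vertex_cover_card_gt_missing_end[OF assms] by auto
qed

lemma vertex_cover_card_gt_second_vertex:
  assumes "vertex_cover G U" "3 \<le> card K" "r0 \<in> K" "v r0 1 \<in> U"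
  shows "2 + (\<Sum>r\<in>K. m r - 1) < card U"
proof (cases "s \<in> U \<and> t \<in> U")
  case True
  then have "U \<inter> {s, t} = {s, t}" by auto
  then have "card U = 2 + (\<Sum>r\<in>K. card (interior r U))"
    using card_eq_sum_interior[of U] assms(1) s_neq_t by (simp add: vertex_cover_def)
  moreover have "(\<Sum>r\<in>K. m r - 1) < (\<Sum>r\<in>K. card (interior r U))"
  proof (rule sum_strict_mono_ex1[OF finite_K])
    show "\<forall>r\<in>K. m r - 1 \<le> card (interior r U)"
      using card_interior_ge[OF assms(1)] by blast
    have "m r0 - 1 < card (interior r0 U)"
      using card_interior_ge_first[OF assms(1,3,4)] m_pos[OF assms(3)] by simp
    then show "\<exists>r\<in>K. m r - 1 < card (interior r U)"
      using assms(3) by blast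
  qed
  ultimately show ?thesis by simp
next
  case False
  then show ?thesis
    using vertex_cover_card_gt_missing_end[OF assms(1,2)] by auto
qed

lemma vc_eq:
  assumes "3 \<le> card K"
  shows "vc G = 2 + (\<Sum>r\<in>K. m r - 1)"
  unfolding vc_def
proof (rule Least_equality)
  \<comment> \<open>An index outside \<open>K\<close> makes every path internal, which attains the
    lower bound.\<close>
  obtain i where "i \<notin> K"
    using ex_new_if_finite[OF infinite_UNIV_nat finite_K] by blast
  moreover have "K \<noteq> {}" using assms by auto
  ultimately show "\<exists>U. vertex_cover G U \<and> card U = 2 + (\<Sum>r\<in>K. m r - 1)"
    using vertex_cover_cover[of i] card_cover[of i] by auto
next
  fix n assume "\<exists>U. vertex_cover G U \<and> card U = n"
  then show "2 + (\<Sum>r\<in>K. m r - 1) \<le> n"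
    using vertex_cover_card_ge[OF _ assms] by blast
qed

section \<open>Lower bound on the size of a class\<close>

lemma evc_class_size_gt:
  assumes "evc_class G n \<U>" "3 \<le> card K"
  shows "vc G < n"
proof -
  have "K \<noteq> {}" using assms(2) by auto
  then obtain r where r: "r \<in> K" by blast
  obtain U where U: "U \<in> \<U>" using assms(1) unfolding evc_class_def by blast
  have cov: "vertex_cover G U'" "card U' = n" if "U' \<in> \<U>" for U'
    using assms(1) that unfolding evc_class_def by blast+
  have "{v r 0, v r (Suc 0)} \<in> edges G"
    using r m_pos[OF r] edges_eq by fastforce
  then obtain \<phi> where "defense G U {v r 0, v r (Suc 0)} \<phi>" and im: "\<phi> ` U \<in> \<U>"
    using assms(1) U unfolding evc_class_def by blast
  \<comment> \<open>A guard has to cross the attacked edge: it either leaves \<open>v r 1\<close> or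
    arrives there. In both cases some member of the class contains \<open>v r 1\<close>, so its size
    exceeds the minimum.\<close>
  then have "v r 1 \<in> U \<or> v r 1 \<in> \<phi> ` U"
    unfolding defense_def by (auto simp: doubleton_eq_iff intro: rev_image_eqI)
  then obtain U' where "U' \<in> \<U>" "v r 1 \<in> U'"
    using U im by blast
  then show ?thesis
    using vertex_cover_card_gt_second_vertex[OF cov(1) assms(2) r] cov(2) vc_eq[OF assms(2)]
    by simp
qed

section \<open>Shifting guards along two paths\<close>

text \<open>Guards at odd positions of path \<open>i\<close> step towards \<open>t\<close>, and
  guards at positive even positions of path \<open>r\<close> step towards \<open>s\<close>. The
  guard on \<open>t\<close> thus enters path \<open>r\<close> and is replaced from path
  \<open>i\<close>; \<open>s\<close> and all other paths are untouched.\<close>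

lemma shift_guards:
  assumes "i \<in> K" "r \<in> K" "i \<noteq> r"
  obtains \<phi> where "\<phi> ` cover i = cover r" "\<forall>x\<in>cover i. \<phi> x \<in> closed_nbhd G x"
    "\<forall>j<m i. \<phi> (v i (2 * j + 1)) = v i (2 * j + 2)"
    "\<forall>j<m r. \<phi> (v r (2 * j + 2)) = v r (2 * j + 1)"
proof -
  \<comment> \<open>\<open>pos\<close> recovers the position from the vertex, since \<phi> has to be
    a map on vertices. The vertex \<open>t\<close> moves as the last vertex of path
    \<open>r\<close>, in the second branch.\<close>
  define pos where "pos l = inv_into {..2 * m l} (v l)" for l
  define \<phi> where "\<phi> x =
    (if \<exists>j<m i. x = v i (2 * j + 1) then v i (Suc (pos i x))
     else if \<exists>j<m r. x = v r (2 * j + 2) then v r (pos r x - 1) else x)" for x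
  have pos: "pos l (v l j) = j" if "l \<in> K" "j \<le> 2 * m l" for l j
    unfolding pos_def by (rule inv_into_f_f) (use v_inj_on that in auto)
  \<comment> \<open>An odd position is never an end, so \<open>v i (2 * j + 1)\<close> lies on path
    \<open>i\<close> only and the two moving branches do not overlap.\<close>
  have ne: "v i (2 * j + 1) \<noteq> v r (2 * j' + 2)" if "j < m i" "j' < m r" for j j'
    using v_eqD[OF assms(1,2), of "2 * j + 1" "2 * j' + 2"] that assms(3)
    by (auto dest: arg_cong[of _ _ even])
  have phi_i: "\<phi> (v i (2 * j + 1)) = v i (2 * j + 2)" if "j < m i" for j
    using that pos[OF assms(1), of "2 * j + 1"] by (auto simp: \<phi>_def)
  have phi_r: "\<phi> (v r (2 * j + 2)) = v r (2 * j + 1)" if "j < m r" for j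
    using that pos[OF assms(2), of "2 * j + 2"] ne[OF _ that] by (fastforce simp: \<phi>_def)
  have phi_fix: "\<phi> x = x"
    if "\<And>j. j < m i \<Longrightarrow> x \<noteq> v i (2 * j + 1)" "\<And>j. j < m r \<Longrightarrow> x \<noteq> v r (2 * j + 2)" for x
    using that by (auto simp: \<phi>_def)
  have edge: "v l (Suc j) \<in> closed_nbhd G (v l j)" "v l j \<in> closed_nbhd G (v l (Suc j))"
    if "l \<in> K" "j < 2 * m l" for l j
  proof -
    have "{v l j, v l (Suc j)} \<in> edges G" "{v l (Suc j), v l j} \<in> edges G"
      "v l j \<in> verts G" "v l (Suc j) \<in> verts G"
      using that by (force simp: edges_eq verts_eq insert_commute)+
    then show "v l (Suc j) \<in> closed_nbhd G (v l j)" "v l j \<in> closed_nbhd G (v l (Suc j))"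
      by (auto simp: closed_nbhd_def)
  qed
  \<comment> \<open>A guard that stays but lies outside \<open>cover r\<close> would be no end, and
    would sit at an odd position of path \<open>i\<close> or an even one of path \<open>r\<close>.
    Those guards all move.\<close>
  have cases_i: "(\<exists>j<m i. x = v i (2 * j + 1)) \<or> (\<exists>j<m r. x = v r (2 * j + 2)) \<or>
      \<phi> x = x \<and> x \<in> cover r" if x: "x \<in> cover i" for x
  proof (rule ccontr)
    assume "\<not> ?thesis"
    then have no: "\<And>j. j < m i \<Longrightarrow> x \<noteq> v i (2 * j + 1)" "\<And>j. j < m r \<Longrightarrow> x \<noteq> v r (2 * j + 2)"
      and "x \<notin> cover r"
      using phi_fix by blast+
    obtain l j where l: "l \<in> K" "j \<le> 2 * m l" "x = v l j"
      "j = 0 \<or> j = 2 * m l \<or> (if l = i then odd j else even j)"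
      using x unfolding cover_def by blast
    have "j \<noteq> 0" "j \<noteq> 2 * m l" and "l = r \<or> odd j"
      using \<open>x \<notin> cover r\<close> l v_in_cover_iff[OF l(1,2), of r] by (auto split: if_splits)
    then consider "l = i" "odd j" | "l = r" "even j"
      using l(4) assms(3) by (auto split: if_splits)
    then show False
    proof cases
      case 1
      then obtain a where "j = 2 * a + 1" by (elim oddE)
      then show False using no(1)[of a] l 1 by simp
    next
      case 2
      then obtain a where "j = 2 * a" by (elim evenE)
      then show False using no(2)[of "a - 1"] l 2 \<open>j \<noteq> 0\<close> by (cases a) auto
    qed
  qed
  have image: "\<phi> ` cover i = cover r"
  proof
    show "\<phi> ` cover i \<subseteq> cover r"
    proof (rule image_subsetI)
      fix x assume "x \<in> cover i"
      from cases_i[OF this] show "\<phi> x \<in> cover r"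
      proof (elim disjE exE conjE)
        fix j assume "j < m i" "x = v i (2 * j + 1)"
        then show ?thesis
          using phi_i[of j] v_in_cover_iff[OF assms(1), of "2 * j + 2" r] assms(3) by simp
      next
        fix j assume "j < m r" "x = v r (2 * j + 2)"
        then show ?thesis
          using phi_r[of j] v_in_cover_iff[OF assms(2), of "2 * j + 1" r] by simp
      qed simp
    qed
    show "cover r \<subseteq> \<phi> ` cover i"
    proof
      fix x assume "x \<in> cover r"
      then obtain l j where l: "l \<in> K" "j \<le> 2 * m l" "x = v l j"
        "j = 0 \<or> j = 2 * m l \<or> (if l = r then odd j else even j)"
        unfolding cover_def by blast
      have img_i: "v i (2 * a + 2) \<in> \<phi> ` cover i" if "a < m i" for a
      proof (rule image_eqI)
        show "v i (2 * a + 2) = \<phi> (v i (2 * a + 1))" using phi_i[OF that] by simp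
        show "v i (2 * a + 1) \<in> cover i"
          using v_in_cover_iff[OF assms(1), of "2 * a + 1" i] that by simp
      qed
      have img_r: "v r (2 * a + 1) \<in> \<phi> ` cover i" if "a < m r" for a
      proof (rule image_eqI)
        show "v r (2 * a + 1) = \<phi> (v r (2 * a + 2))" using phi_r[OF that] by simp
        show "v r (2 * a + 2) \<in> cover i"
          using v_in_cover_iff[OF assms(2), of "2 * a + 2" i] that assms(3) by simp
      qed
      \<comment> \<open>The cases say where the guard on a vertex of \<open>cover r\<close> comes
        from. The vertex \<open>t\<close> stands apart: it is vacated and refilled from the last odd
        position of path \<open>i\<close>. In the final case, which contains \<open>s\<close>, the
        guard has not moved.\<close>
      consider "j = 2 * m l" | "l = i" "even j" "j \<noteq> 0" | "l = r" "odd j"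
        | "j \<noteq> 2 * m l" "j = 0 \<or> l \<noteq> i \<and> l \<noteq> r \<and> even j"
        using l(4) assms(3) m_pos[OF l(1)] by (auto split: if_splits)
      then show "x \<in> \<phi> ` cover i"
      proof cases
        case 1
        have "2 * (m i - 1) + 2 = 2 * m i" using m_pos[OF assms(1)] by simp
        then show ?thesis
          using 1 img_i[of "m i - 1"] l m_pos[OF assms(1)] v_last[OF assms(1)] v_last[OF l(1)]
          by simp
      next
        case 2
        then obtain a where "j = 2 * a" by (elim evenE)
        then show ?thesis using 2 l img_i[of "a - 1"] by (cases a) auto
      next
        case 3
        then obtain a where "j = 2 * a + 1" by (elim oddE)
        then show ?thesis using 3 l img_r[of a] by simp
      next
        case 4
        have "x \<noteq> v i (2 * a + 1)" if "a < m i" for a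
          using v_eqD[OF l(1) assms(1) l(2), of "2 * a + 1"] that 4 l(3) by auto
        moreover have "x \<noteq> v r (2 * a + 2)" if "a < m r" for a
          using v_eqD[OF l(1) assms(2) l(2), of "2 * a + 2"] that 4 l(3) by auto
        ultimately have "\<phi> x = x" by (rule phi_fix)
        moreover have "x \<in> cover i"
          using 4 l v_in_cover_iff[OF l(1,2), of i] by auto
        ultimately show ?thesis by (metis image_eqI)
      qed
    qed
  qed
  have nbhd: "\<phi> x \<in> closed_nbhd G x" if "x \<in> cover i" for x
    using cases_i[OF that]
  proof (elim disjE exE conjE)
    fix j assume "j < m i" "x = v i (2 * j + 1)"
    then show ?thesis using phi_i[of j] edge(1)[OF assms(1), of "2 * j + 1"] by simp
  next
    fix j assume "j < m r" "x = v r (2 * j + 2)"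
    then show ?thesis using phi_r[of j] edge(2)[OF assms(2), of "2 * j + 1"] by simp
  qed (simp add: closed_nbhd_def)
  show thesis
    by (rule that[OF image]) (use nbhd phi_i phi_r in blast)+
qed

text \<open>Every move of the shift is between positions \<open>2 * a + 1\<close> and
  \<open>2 * a + 2\<close>, so each edge of the two paths starting at an odd position is
  crossed.\<close>

lemma shift_defends_odd:
  assumes "i \<in> K" "r \<in> K" "i \<noteq> r" "l = i \<or> l = r" "j < 2 * m l" "odd j"
  shows "\<exists>\<phi>. defense G (cover i) {v l j, v l (Suc j)} \<phi> \<and> \<phi> ` cover i = cover r"
proof -
  obtain \<phi> where phi: "\<phi> ` cover i = cover r" "\<forall>x\<in>cover i. \<phi> x \<in> closed_nbhd G x"
    "\<forall>j<m i. \<phi> (v i (2 * j + 1)) = v i (2 * j + 2)"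
    "\<forall>j<m r. \<phi> (v r (2 * j + 2)) = v r (2 * j + 1)"
    using shift_guards[OF assms(1-3)] by blast
  have ne: "K \<noteq> {}" using assms(1) by blast
  \<comment> \<open>Both indices lie in \<open>K\<close>, so the two covers have equal size, and a
    surjection between finite sets of equal size is injective.\<close>
  have "inj_on \<phi> (cover i)"
    by (rule eq_card_imp_inj_on)
      (use vertex_cover_cover card_cover[OF ne] assms(1,2) phi(1) in \<open>auto simp: vertex_cover_def\<close>)
  moreover have "\<phi> \<in> cover i \<rightarrow> verts G"
    using phi(1) cover_subset_verts[of r] by blast
  moreover have "v l j \<in> cover i \<and> \<phi> (v l j) = v l (Suc j) \<or>
      v l (Suc j) \<in> cover i \<and> \<phi> (v l (Suc j)) = v l j"
  proof -
    obtain a where a: "j = 2 * a + 1" using assms(6) by (elim oddE)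
    then have "a < m l" using assms(5) by simp
    then show ?thesis
      using assms(1-5) a phi(3,4) v_in_cover_iff[of i j i] v_in_cover_iff[of r "Suc j" i] by auto
  qed
  ultimately show ?thesis
    using phi(1,2) unfolding defense_def by blast
qed

text \<open>Reading all paths from \<open>t\<close> to \<open>s\<close> yields the shift through
  \<open>s\<close> from the one through \<open>t\<close>, without a second construction.\<close>

lemma reversed: "even_melon_coords G K m (\<lambda>r j. v r (2 * m r - j)) t s"
proof
  fix r r' j j'
  assume *: "r \<in> K" "r' \<in> K" "j \<le> 2 * m r" "j' \<le> 2 * m r'"
    "v r (2 * m r - j) = v r' (2 * m r' - j')"
  show "r = r' \<and> j = j' \<or> j = 0 \<and> j' = 0 \<or> j = 2 * m r \<and> j' = 2 * m r'"
    using v_eqD[OF *(1,2) _ _ *(5)] *(3,4) by auto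
next
  show "verts G = {v r (2 * m r - j) | r j. r \<in> K \<and> j \<le> 2 * m r}"
  proof -
    have "\<exists>j'\<le>2 * m r. v r j = v r (2 * m r - j')" if "j \<le> 2 * m r" for r j
      by (rule exI[of _ "2 * m r - j"]) (use that in simp)
    then show ?thesis unfolding verts_eq by fastforce
  qed
next
  have "\<exists>j'<2 * m r. {v r j, v r (Suc j)} = {v r (2 * m r - j'), v r (2 * m r - Suc j')}"
    if "j < 2 * m r" for r j
    by (rule exI[of _ "2 * m r - Suc j"]) (use that in \<open>auto simp: Suc_diff_Suc\<close>)
  moreover have "\<exists>j'<2 * m r. {v r (2 * m r - j), v r (2 * m r - Suc j)} = {v r j', v r (Suc j')}"
    if "j < 2 * m r" for r j
    by (rule exI[of _ "2 * m r - Suc j"]) (use that in \<open>auto simp: Suc_diff_Suc\<close>)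
  ultimately show "edges G =
      {{v r (2 * m r - j), v r (2 * m r - Suc j)} | r j. r \<in> K \<and> j < 2 * m r}"
    unfolding edges_eq by (intro set_eqI iffI; simp only: mem_Collect_eq; metis)
qed (use finite_K m_pos s_neq_t v_first v_last in auto)

text \<open>Reversal sends position \<open>j\<close> to \<open>2 * m r - j\<close>, which has the
  same parity, and exchanges the ends.\<close>

lemma cover_reversed: "even_melon_coords.cover K m (\<lambda>r j. v r (2 * m r - j)) i = cover i"
proof -
  interpret rev: even_melon_coords G K m "\<lambda>r j. v r (2 * m r - j)" t s
    by (rule reversed)
  have mem: "v r (2 * m r - j) \<in> rev.cover i \<longleftrightarrow> v r (2 * m r - j) \<in> cover i"
    if "r \<in> K" "j \<le> 2 * m r" for r j
    using that rev.v_in_cover_iff[OF that, of i] v_in_cover_iff[OF that(1), of "2 * m r - j" i]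
    by auto
  have "x \<in> rev.cover i \<longleftrightarrow> x \<in> cover i" if "x \<in> verts G" for x
    using that mem unfolding rev.verts_eq by blast
  then show ?thesis
    using cover_subset_verts[of i] rev.cover_subset_verts[of i] by blast
qed

lemma shift_defends:
  assumes "i \<in> K" "r \<in> K" "i \<noteq> r" "l = i \<or> l = r" "j < 2 * m l"
  shows "\<exists>\<phi>. defense G (cover i) {v l j, v l (Suc j)} \<phi> \<and> \<phi> ` cover i = cover r"
proof (cases "odd j")
  case True
  then show ?thesis using shift_defends_odd assms by blast
next
  case False
  interpret rev: even_melon_coords G K m "\<lambda>r j. v r (2 * m r - j)" t s
    by (rule reversed)
  \<comment> \<open>The edge starting at an even \<open>j\<close> starts at the odd position
    \<open>2 * m l - Suc j\<close> of the reversed path.\<close>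
  have "2 * m l - (2 * m l - Suc j) = Suc j" "2 * m l - Suc (2 * m l - Suc j) = j"
    using assms(5) by auto
  moreover have "odd (2 * m l - Suc j)" using False assms(5) by simp
  ultimately show ?thesis
    using rev.shift_defends_odd[OF assms(1-4), of "2 * m l - Suc j"] assms(5)
    by (simp add: cover_reversed insert_commute)
qed

section \<open>The eternal vertex cover class\<close>

lemma evc_class_cover:
  assumes "3 \<le> card K"
  shows "evc_class G (vc G + 1) (cover ` K)"
proof -
  have ne: "K \<noteq> {}" using assms by auto
  have "\<exists>\<phi>. defense G (cover i) e \<phi> \<and> \<phi> ` cover i \<in> cover ` K"
    if i: "i \<in> K" and e: "e \<in> edges G" for i e
  proof -
    obtain l j where l: "l \<in> K" "j < 2 * m l" "e = {v l j, v l (Suc j)}"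
      using e edges_eq by blast
    have "\<exists>r\<in>K. r \<noteq> i"
    proof (rule ccontr)
      assume "\<not> ?thesis"
      then have "K \<subseteq> {i}" by blast
      then have "card K \<le> 1" using card_mono[of "{i}" K] by simp
      then show False using assms by simp
    qed
    \<comment> \<open>The target is the path with the attacked edge or, if that is path
      \<open>i\<close> itself, any other path.\<close>
    then obtain r where "r \<in> K" "i \<noteq> r" "l = i \<or> l = r"
      using l(1) by metis
    then show ?thesis
      using shift_defends[OF i, of r l j] l by (metis imageI)
  qed
  then show ?thesis
    unfolding evc_class_def
    using ne vertex_cover_cover card_cover[OF ne] vc_eq[OF assms] by auto
qed

lemma evc_eq:
  assumes "3 \<le> card K"
  shows "evc G = vc G + 1"
  unfolding evc_def
proof (rule Least_equality)
  show "\<exists>\<U>. evc_class G (vc G + 1) \<U>"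
    using evc_class_cover[OF assms] by blast
next
  fix n assume "\<exists>\<U>. evc_class G n \<U>"
  then obtain \<U> where "evc_class G n \<U>" by blast
  from evc_class_size_gt[OF this assms] show "vc G + 1 \<le> n" by simp
qed

end

section \<open>From vertex lists to coordinates\<close>

text \<open>\<open>path_between\<close> fixes the ends only as a set, so a list may run from
  \<open>t\<close> to \<open>s\<close>; such a list is read backwards.\<close>

definition oriented_nth :: "(nat \<Rightarrow> 'a list) \<Rightarrow> 'a \<Rightarrow> nat \<Rightarrow> nat \<Rightarrow> 'a" where
  "oriented_nth P s i j = (if hd (P i) = s then P i ! j else P i ! (path_length (P i) - j))"

text \<open>A set of positions that is symmetric under reversal selects the same vertices in both
  directions. On paths of even length this applies to parity conditions.\<close>

lemma oriented_nth_image: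
  assumes "\<And>j. j \<le> path_length (P i) \<Longrightarrow> Q (path_length (P i) - j) = Q j"
  shows "{oriented_nth P s i j | j. j \<le> path_length (P i) \<and> Q j} =
    {P i ! j | j. j \<le> path_length (P i) \<and> Q j}"
proof (cases "hd (P i) = s")
  case False
  let ?n = "path_length (P i)"
  have "{P i ! (?n - j) | j. j \<le> ?n \<and> Q j} = {P i ! j | j. j \<le> ?n \<and> Q j}"
  proof (intro equalityI subsetI)
    fix x assume "x \<in> {P i ! (?n - j) | j. j \<le> ?n \<and> Q j}"
    then obtain j where "x = P i ! (?n - j)" "j \<le> ?n" "Q j" by blast
    then show "x \<in> {P i ! j | j. j \<le> ?n \<and> Q j}"
      using assms[of j] by (auto intro!: exI[of _ "?n - j"])
  next
    fix x assume "x \<in> {P i ! j | j. j \<le> ?n \<and> Q j}"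
    then obtain j where "x = P i ! j" "j \<le> ?n" "Q j" by blast
    then show "x \<in> {P i ! (?n - j) | j. j \<le> ?n \<and> Q j}"
      using assms[of j] by (auto intro!: exI[of _ "?n - j"])
  qed
  then show ?thesis using False by (simp add: oriented_nth_def)
qed (simp add: oriented_nth_def)

lemma set_eq_oriented_nth:
  assumes "P i \<noteq> []"
  shows "set (P i) = {oriented_nth P s i j | j. j \<le> path_length (P i)}"
proof -
  have "set (P i) = {P i ! j | j. j \<le> path_length (P i) \<and> True}"
    using assms by (cases "P i") (auto simp: set_conv_nth path_length_def less_Suc_eq_le)
  then show ?thesis
    using oriented_nth_image[of P i "\<lambda>_. True" s] by simp
qed

lemma path_edges_eq_oriented_nth:
  "path_edges (P i) =
    {{oriented_nth P s i j, oriented_nth P s i (Suc j)} | j. j < path_length (P i)}"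
proof (cases "hd (P i) = s")
  case False
  let ?n = "path_length (P i)"
  \<comment> \<open>Edge \<open>j\<close> of a path is edge \<open>?n - Suc j\<close> of the
    reversed path.\<close>
  have flip: "{P i ! j, P i ! Suc j} = {P i ! (?n - (?n - Suc j)), P i ! (?n - Suc (?n - Suc j))}"
    "{P i ! (?n - j), P i ! (?n - Suc j)} = {P i ! (?n - Suc j), P i ! Suc (?n - Suc j)}"
    "?n - Suc j < ?n" if "j < ?n" for j
    using that by (auto simp: Suc_diff_Suc)
  have "path_edges (P i) = {{P i ! (?n - j), P i ! (?n - Suc j)} | j. j < ?n}"
    unfolding path_edges_def
  proof (intro equalityI subsetI)
    fix e assume "e \<in> {{P i ! j, P i ! Suc j} | j. j < ?n}"
    then obtain j where "e = {P i ! j, P i ! Suc j}" "j < ?n" by blast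
    then show "e \<in> {{P i ! (?n - j), P i ! (?n - Suc j)} | j. j < ?n}"
      using flip(1,3)[of j] by blast
  next
    fix e assume "e \<in> {{P i ! (?n - j), P i ! (?n - Suc j)} | j. j < ?n}"
    then obtain j where "e = {P i ! (?n - j), P i ! (?n - Suc j)}" "j < ?n" by blast
    then show "e \<in> {{P i ! j, P i ! Suc j} | j. j < ?n}"
      using flip(2,3)[of j] by blast
  qed
  then show ?thesis using False by (simp add: oriented_nth_def)
qed (simp add: oriented_nth_def path_edges_def)

lemma even_melon_coords_oriented_nth:
  assumes "even_melon k G P s t"
  shows "even_melon_coords G {1..k} (\<lambda>i. path_length (P i) div 2) (oriented_nth P s) s t"
proof -
  let ?m = "\<lambda>i. path_length (P i) div 2"
  let ?v = "oriented_nth P s"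
  note mel = assms[unfolded even_melon_def melon_def path_between_def]
  have st: "s \<noteq> t" using mel by blast
  have len: "2 * ?m i = path_length (P i)" "length (P i) = Suc (2 * ?m i)" "0 < ?m i"
    and dist: "distinct (P i)" and nonempty: "P i \<noteq> []" and ends: "{hd (P i), last (P i)} = {s, t}"
    if "i \<in> {1..k}" for i
  proof -
    have i: "1 \<le> path_length (P i)" "even (path_length (P i))"
      and "P i \<noteq> []" "distinct (P i)" "{hd (P i), last (P i)} = {s, t}"
      using mel that by simp_all
    then show "P i \<noteq> []" "distinct (P i)" "{hd (P i), last (P i)} = {s, t}"
      by blast+
    show n: "2 * ?m i = path_length (P i)" using i(2) by simp
    \<comment> \<open>An even length that is at least 1 is at least 2, so its half is
      positive.\<close>
    then show "length (P i) = Suc (2 * ?m i)" "0 < ?m i"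
      using i(1) by (auto simp: path_length_def)
  qed
  have v_first: "?v i 0 = s" and v_last: "?v i (2 * ?m i) = t" if "i \<in> {1..k}" for i
    using ends[OF that] st nonempty[OF that] len(1)[OF that]
    by (auto simp: oriented_nth_def hd_conv_nth last_conv_nth path_length_def doubleton_eq_iff)
  have v_set: "?v i j \<in> set (P i)" if "i \<in> {1..k}" "j \<le> 2 * ?m i" for i j
    using that len[OF that(1)] by (auto simp: oriented_nth_def)
  have v_inj: "j = j'" if "i \<in> {1..k}" "j \<le> 2 * ?m i" "j' \<le> 2 * ?m i" "?v i j = ?v i j'" for i j j'
    using that len[OF that(1)] dist[OF that(1)]
    by (auto simp: oriented_nth_def nth_eq_iff_index_eq split: if_splits)
  have set_P: "set (P i) = {?v i j | j. j \<le> 2 * ?m i}" if "i \<in> {1..k}" for i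
    using set_eq_oriented_nth[of P i s] nonempty[OF that] len(1)[OF that] by simp
  have edges_P: "path_edges (P i) = {{?v i j, ?v i (Suc j)} | j. j < 2 * ?m i}" if "i \<in> {1..k}" for i
    using path_edges_eq_oriented_nth[of P i s] len(1)[OF that] by simp
  show ?thesis
  proof
    fix r r' j j'
    assume *: "r \<in> {1..k}" "r' \<in> {1..k}" "j \<le> 2 * ?m r" "j' \<le> 2 * ?m r'" "?v r j = ?v r' j'"
    show "r = r' \<and> j = j' \<or> j = 0 \<and> j' = 0 \<or> j = 2 * ?m r \<and> j' = 2 * ?m r'"
    proof (cases "r = r'")
      case True
      then show ?thesis using v_inj * by blast
    next
      case False
      then have "(set (P r) - {s, t}) \<inter> (set (P r') - {s, t}) = {}"
        using mel *(1,2) by simp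
      \<comment> \<open>A vertex common to two paths is an end by internal disjointness; injectivity
        on each path then fixes both positions.\<close>
      then have "?v r j \<in> {s, t}"
        using *(5) v_set[OF *(1,3)] v_set[OF *(2,4)] by auto
      then show ?thesis
        using v_inj[OF *(1,3), of 0] v_inj[OF *(1,3), of "2 * ?m r"]
          v_inj[OF *(2,4), of 0] v_inj[OF *(2,4), of "2 * ?m r'"] *(5)
          v_first[OF *(1)] v_first[OF *(2)] v_last[OF *(1)] v_last[OF *(2)] by auto
    qed
  next
    show "verts G = {?v r j | r j. r \<in> {1..k} \<and> j \<le> 2 * ?m r}"
    proof -
      have "verts G = (\<Union>i\<in>{1..k}. {?v i j | j. j \<le> 2 * ?m i})"
        using mel set_P by auto
      then show ?thesis by blast
    qed
    show "edges G = {{?v r j, ?v r (Suc j)} | r j. r \<in> {1..k} \<and> j < 2 * ?m r}"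
    proof -
      have "edges G = (\<Union>i\<in>{1..k}. {{?v i j, ?v i (Suc j)} | j. j < 2 * ?m i})"
        using mel edges_P by auto
      then show ?thesis by blast
    qed
  qed (use st len v_first v_last in auto)
qed

section \<open>Identifying the covers of the statement\<close>

lemma internal_path_oriented_nth:
  assumes "even (path_length (P i))"
  shows "internal_path (P i) U \<longleftrightarrow>
    U \<inter> set (P i) = {oriented_nth P s i j | j. j \<le> path_length (P i) \<and> even j}"
proof -
  have "{P i ! (2 * j) | j. j \<le> path_length (P i) div 2} =
      {P i ! j | j. j \<le> path_length (P i) \<and> even j}"
    using assms by (fastforce elim!: evenE)
  also have "\<dots> = {oriented_nth P s i j | j. j \<le> path_length (P i) \<and> even j}"
    by (rule oriented_nth_image[symmetric]) (use assms in auto)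
  finally show ?thesis
    by (simp add: internal_path_def)
qed

lemma external_path_oriented_nth:
  assumes "P i \<noteq> []" "even (path_length (P i))"
  shows "external_path (P i) U \<longleftrightarrow> U \<inter> set (P i) =
    {oriented_nth P s i j | j. j \<le> path_length (P i) \<and> (j = 0 \<or> j = path_length (P i) \<or> odd j)}"
proof -
  let ?n = "path_length (P i)"
  have "{P i ! (2 * j + 1) | j. j < ?n div 2} = {P i ! j | j. j \<le> ?n \<and> odd j}"
  proof (intro equalityI subsetI)
    fix x assume "x \<in> {P i ! (2 * j + 1) | j. j < ?n div 2}"
    then obtain j where "x = P i ! (2 * j + 1)" "j < ?n div 2" by blast
    then show "x \<in> {P i ! j | j. j \<le> ?n \<and> odd j}"
      by (auto intro!: exI[of _ "2 * j + 1"])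
  next
    fix x assume "x \<in> {P i ! j | j. j \<le> ?n \<and> odd j}"
    then obtain j where "x = P i ! j" "j \<le> ?n" "odd j" by blast
    moreover from \<open>odd j\<close> obtain a where "j = 2 * a + 1" by (elim oddE)
    ultimately show "x \<in> {P i ! (2 * j + 1) | j. j < ?n div 2}"
      using assms(2) by (auto intro!: exI[of _ a] elim!: evenE)
  qed
  then have "{P i ! (2 * j + 1) | j. j < ?n div 2} \<union> {hd (P i), last (P i)} =
      {P i ! j | j. j \<le> ?n \<and> odd j} \<union> {P i ! 0, P i ! ?n}"
    using assms(1) by (simp add: hd_conv_nth last_conv_nth path_length_def)
  also have "\<dots> = {P i ! j | j. j \<le> ?n \<and> (j = 0 \<or> j = ?n \<or> odd j)}"
    by blast
  also have "\<dots> = {oriented_nth P s i j | j. j \<le> ?n \<and> (j = 0 \<or> j = ?n \<or> odd j)}"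
    by (rule oriented_nth_image[symmetric]) (use assms(2) in auto)
  finally show ?thesis
    by (simp add: external_path_def)
qed

text \<open>The external and internal conditions decide membership at every position of every path,
  and the paths exhaust the vertices. Hence the described set is unique; it exists because
  \<open>cover i\<close> meets the conditions.\<close>

lemma melon_cover_eq:
  assumes "even_melon k G P s t" "i \<in> {1..k}"
  shows "melon_cover k G P i =
    even_melon_coords.cover {1..k} (\<lambda>i. path_length (P i) div 2) (oriented_nth P s) i"
proof -
  let ?v = "oriented_nth P s"
  interpret even_melon_coords G "{1..k}" "\<lambda>i. path_length (P i) div 2" ?v s t
    by (rule even_melon_coords_oriented_nth[OF assms(1)])
  have P: "P r \<noteq> []" "even (path_length (P r))" "2 * (path_length (P r) div 2) = path_length (P r)"
    if "r \<in> {1..k}" for r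
    using assms(1) that by (auto simp: even_melon_def melon_def path_between_def)
  \<comment> \<open>Positions on one path name distinct vertices, so an equation between sets of
    vertices becomes a condition at each position.\<close>
  have inter: "U \<inter> set (P r) = {?v r j | j. j \<le> path_length (P r) \<and> Q j} \<longleftrightarrow>
      (\<forall>j\<le>path_length (P r). ?v r j \<in> U \<longleftrightarrow> Q j)" if r: "r \<in> {1..k}" for r U Q
  proof -
    have "j = j'" if "j \<le> path_length (P r)" "j' \<le> path_length (P r)" "?v r j = ?v r j'" for j j'
      using v_inj_on[OF r] that P(3)[OF r] by (auto dest: inj_onD)
    then show ?thesis
      unfolding set_eq_oriented_nth[of P r s, OF P(1)[OF r]] by blast
  qed
  have int: "internal_path (P r) U \<longleftrightarrow> (\<forall>j\<le>path_length (P r). ?v r j \<in> U \<longleftrightarrow> even j)"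
    if "r \<in> {1..k}" for r U
    using inter[OF that] internal_path_oriented_nth[of P r U s] P[OF that] by simp
  have ext: "external_path (P r) U \<longleftrightarrow>
      (\<forall>j\<le>path_length (P r). ?v r j \<in> U \<longleftrightarrow> j = 0 \<or> j = path_length (P r) \<or> odd j)"
    if "r \<in> {1..k}" for r U
    using inter[OF that] external_path_oriented_nth[of P r U s] P[OF that] by simp
  have mem: "?v r j \<in> cover i \<longleftrightarrow>
      j = 0 \<or> j = path_length (P r) \<or> (if r = i then odd j else even j)"
    if "r \<in> {1..k}" "j \<le> path_length (P r)" for r j
    using v_in_cover_iff[OF that(1), of j i] that P(3)[OF that(1)] by simp
  show ?thesis
    unfolding melon_cover_def
  proof (rule the_equality, intro conjI ballI impI)
    show "cover i \<subseteq> verts G" by (rule cover_subset_verts)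
    show "external_path (P i) (cover i)"
      using ext[OF assms(2)] mem[OF assms(2)] by simp
    show "internal_path (P r) (cover i)" if "r \<in> {1..k}" "r \<noteq> i" for r
      using int[OF that(1)] mem[OF that(1)] that(2) P(2)[OF that(1)] by auto
  next
    fix U
    assume U: "U \<subseteq> verts G \<and> external_path (P i) U \<and>
      (\<forall>j\<in>{1..k}. j \<noteq> i \<longrightarrow> internal_path (P j) U)"
    have "?v r j \<in> U \<longleftrightarrow> ?v r j \<in> cover i" if "r \<in> {1..k}" "j \<le> path_length (P r)" for r j
      using U int[OF that(1), of U] ext[OF that(1), of U] mem[OF that] that P(2)[OF that(1)]
      by (cases "r = i") auto
    moreover have "\<exists>r j. r \<in> {1..k} \<and> j \<le> path_length (P r) \<and> x = ?v r j" if "x \<in> verts G" for x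
      using that P(3) unfolding verts_eq by fastforce
    ultimately show "U = cover i"
      using U cover_subset_verts by blast
  qed
qed

theorem theorem11:
  fixes G :: "'a ugraph" and P :: "nat \<Rightarrow> 'a list" and s t :: 'a and k :: nat
  assumes "k \<ge> 3"
    and "even_melon k G P s t"
  shows "evc G = vc G + 1 \<and> minimum_evc_class G {melon_cover k G P i | i. i \<in> {1..k}}"
proof -
  interpret even_melon_coords G "{1..k}" "\<lambda>i. path_length (P i) div 2" "oriented_nth P s" s t
    by (rule even_melon_coords_oriented_nth[OF assms(2)])
  have "{melon_cover k G P i | i. i \<in> {1..k}} = melon_cover k G P ` {1..k}"
    by blast
  also have "\<dots> = cover ` {1..k}"
    by (rule image_cong) (use melon_cover_eq[OF assms(2)] in auto)
  finally show ?thesis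
    using evc_eq evc_class_cover assms(1) by (simp add: minimum_evc_class_def)
qed

end
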